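(* Let $\alpha\in(0,1)$, $\theta>-\alpha$, and let $K_n$ be the number of types in a sample of size $n$ from the Ewens-Pitman model with parameters $(\alpha,\theta)$. Then for all integers $1\le k\le n$, $$ \mathbb{P}(K_n = k) = \frac{n!}{k!}\, \frac{\left( \frac{\theta}{\alpha} \right)_{k\uparrow 1}}{(\theta)_{n\uparrow1 }}\, \frac{1}{2\pi \mathrm{i}} \int_{C} \frac{(1 - (1 - z)^{\alpha})^k}{z^{n+1}}\, dz, $$ where $C$ is a circle $|z|=r$ with $0<r<1$.
   Context: Ewens-Pitman model: for $\alpha\in(0,1)$, $\theta+\alpha>0$ and $n\ge1$, let $M_{ln}$ ($1\le l\le n$) be the number of types represented exactly $l$ times in a sample of size $n$, and $K_n=\sum_{l=1}^n M_{ln}$ the number of types. For nonnegative integers $m_1,\dots,m_n$ with $\sum_j m_j=k$ and $\sum_j j m_j=n$, $$\mathbb{P}(M_{1n}=m_1,\dots,M_{nn}=m_n,K_n=k)=n!\,\frac{\prod_{i=1}^{k}(\theta+(i-1)\alpha)}{(\theta)_{n\uparrow1}}\prod_{j=1}^n\left(\frac{(1-\alpha)_{j-1\uparrow1}}{j!}\right)^{m_j}\frac{1}{m_j!},$$ where $(a)_{m\uparrow1}=\Gamma(a+m)/\Gamma(a)=a(a+1)\cdots(a+m-1)$. At $\theta=0$ the common factor $\theta$ in numerator and denominator of ratios such as $(\theta/\alpha)_{k\uparrow1}/(\theta)_{n\uparrow1}$ is cancelled (limit $\theta\to0$). The power $(1-z)^\alpha$ is the principal branch, with branch cut $[1,\infty)$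 in $z$; $C$ is positively oriented; $\mathrm{i}=\sqrt{-1}$. *)

theory Defs
  imports "HOL-Probability.Probability" "HOL-Complex_Analysis.Complex_Analysis"
begin

text \<open>A sample of size n is a family X of observed types indexed by the draws 1, ..., n.\<close>

definition type_multiplicity :: "(nat \<Rightarrow> 'a \<Rightarrow> 't) \<Rightarrow> nat \<Rightarrow> 'a \<Rightarrow> 't \<Rightarrow> nat" where
  "type_multiplicity X n \<omega> t = card {i \<in> {1..n}. X i \<omega> = t}"

definition types_with_multiplicity :: "(nat \<Rightarrow> 'a \<Rightarrow> 't) \<Rightarrow> nat \<Rightarrow> nat \<Rightarrow> 'a \<Rightarrow> nat" where
  "types_with_multiplicity X n l \<omega> = card {t. type_multiplicity X n \<omega> t = l}"

definition num_types :: "(nat \<Rightarrow> 'a \<Rightarrow> 't) \<Rightarrow> nat \<Rightarrow> 'a \<Rightarrow> nat" where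
  "num_types X n \<omega> = (\<Sum>l=1..n. types_with_multiplicity X n l \<omega>)"

lemma num_types_eq_card: "num_types X n \<omega> = card ((\<lambda>i. X i \<omega>) ` {1..n})"
proof -
  let ?A = "\<lambda>l. {t. type_multiplicity X n \<omega> t = l}"
  let ?S = "(\<lambda>i. X i \<omega>) ` {1..n}"
  have pos: "type_multiplicity X n \<omega> t \<ge> 1 \<longleftrightarrow> t \<in> ?S" for t
  proof -
    have "finite {i \<in> {1..n}. X i \<omega> = t}" by simp
    then have "type_multiplicity X n \<omega> t \<ge> 1 \<longleftrightarrow> {i \<in> {1..n}. X i \<omega> = t} \<noteq> {}"
      unfolding type_multiplicity_def by (metis One_nat_def Suc_leI card_gt_0_iff less_eq_Suc_le)
    then show ?thesis by auto
  qed
  have le: "type_multiplicity X n \<omega> t \<le> n" for t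
  proof -
    have "type_multiplicity X n \<omega> t \<le> card {1..n}"
      unfolding type_multiplicity_def by (rule card_mono) auto
    then show ?thesis by simp
  qed
  have un: "?S = (\<Union>l\<in>{1..n}. ?A l)"
    using pos le by auto
  have fin: "finite (?A l)" if "l \<in> {1..n}" for l
    using un that by (metis UN_upper finite_atLeastAtMost finite_imageI finite_subset)
  have "card ?S = (\<Sum>l\<in>{1..n}. card (?A l))"
    unfolding un by (rule card_UN_disjoint) (use fin in auto)
  then show ?thesis
    unfolding num_types_def types_with_multiplicity_def by simp
qed

text \<open>
  The two ratios below are used for \<open>k, n \<ge> 1\<close>. Numerator and denominator both vanish at
  \<open>\<theta> = 0\<close>, where the common factor \<open>\<theta>\<close> is cancelled; the limit lemmas confirm the values.
\<close>

definition ep_weight_ratio :: "real \<Rightarrow> real \<Rightarrow> nat \<Rightarrow> nat \<Rightarrow> real" where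
  "ep_weight_ratio \<alpha> \<theta> k n =
     (if \<theta> = 0 then (\<Prod>i=2..k. (real i - 1) * \<alpha>) / pochhammer 1 (n - 1)
      else (\<Prod>i=1..k. \<theta> + (real i - 1) * \<alpha>) / pochhammer \<theta> n)"

definition ep_pochhammer_ratio :: "real \<Rightarrow> real \<Rightarrow> nat \<Rightarrow> nat \<Rightarrow> real" where
  "ep_pochhammer_ratio \<alpha> \<theta> k n =
     (if \<theta> = 0 then (1 / \<alpha>) * pochhammer 1 (k - 1) / pochhammer 1 (n - 1)
      else pochhammer (\<theta> / \<alpha>) k / pochhammer \<theta> n)"

lemma tendsto_pochhammer_real:
  fixes f :: "'a \<Rightarrow> real"
  assumes "(f \<longlongrightarrow> c) F"
  shows "((\<lambda>x. pochhammer (f x) m) \<longlongrightarrow> pochhammer c m) F"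
  unfolding pochhammer_prod by (intro tendsto_intros assms)

lemma ep_weight_ratio_limit:
  assumes "k \<ge> 1" "n \<ge> 1"
  shows "((\<lambda>\<theta>. (\<Prod>i=1..k. \<theta> + (real i - 1) * \<alpha>) / pochhammer \<theta> n)
           \<longlongrightarrow> ep_weight_ratio \<alpha> 0 k n) (at 0)"
proof -
  obtain n' where n': "n = Suc n'" using assms by (cases n) auto
  have split: "(\<Prod>i=1..k. \<theta> + (real i - 1) * \<alpha>) = \<theta> * (\<Prod>i=2..k. \<theta> + (real i - 1) * \<alpha>)" for \<theta>
    using assms by (simp add: prod.atLeast_Suc_atMost numeral_2_eq_2)
  have "((\<lambda>\<theta>. (\<Prod>i=2..k. \<theta> + (real i - 1) * \<alpha>) / pochhammer (\<theta> + 1) n')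
          \<longlongrightarrow> (\<Prod>i=2..k. 0 + (real i - 1) * \<alpha>) / pochhammer (0 + 1) n') (at 0)"
    by (intro tendsto_intros tendsto_pochhammer_real) (simp add: pochhammer_fact[symmetric])
  moreover have "\<forall>\<^sub>F \<theta> in at 0. (\<Prod>i=2..k. \<theta> + (real i - 1) * \<alpha>) / pochhammer (\<theta> + 1) n'
      = (\<Prod>i=1..k. \<theta> + (real i - 1) * \<alpha>) / pochhammer \<theta> n"
    unfolding split n' pochhammer_rec by (auto simp: eventually_at_filter)
  ultimately show ?thesis
    by (subst (asm) tendsto_cong) (auto simp: ep_weight_ratio_def n')
qed

lemma ep_pochhammer_ratio_limit:
  assumes "k \<ge> 1" "n \<ge> 1"
  shows "((\<lambda>\<theta>. pochhammer (\<theta> / \<alpha>) k / pochhammer \<theta> n)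
           \<longlongrightarrow> ep_pochhammer_ratio \<alpha> 0 k n) (at 0)"
proof -
  obtain n' where n': "n = Suc n'" using assms by (cases n) auto
  obtain k' where k': "k = Suc k'" using assms by (cases k) auto
  have "((\<lambda>\<theta>. (1 / \<alpha>) * pochhammer (\<theta> * (1 / \<alpha>) + 1) k' / pochhammer (\<theta> + 1) n')
          \<longlongrightarrow> (1 / \<alpha>) * pochhammer (0 * (1 / \<alpha>) + 1) k' / pochhammer (0 + 1) n') (at 0)"
    by (intro tendsto_intros tendsto_pochhammer_real) (simp add: pochhammer_fact[symmetric])
  moreover have "\<forall>\<^sub>F \<theta> in at 0. (1 / \<alpha>) * pochhammer (\<theta> * (1 / \<alpha>) + 1) k' / pochhammer (\<theta> + 1) n'
      = pochhammer (\<theta> / \<alpha>) k / pochhammer \<theta> n"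
    unfolding n' k' pochhammer_rec by (auto simp: eventually_at_filter)
  ultimately show ?thesis
    by (subst (asm) tendsto_cong) (auto simp: ep_pochhammer_ratio_def n' k')
qed

locale ewens_pitman_sample = prob_space P
  for P :: "'a measure" and X :: "nat \<Rightarrow> 'a \<Rightarrow> 't" and \<alpha> \<theta> :: real and n :: nat +
  assumes measurable_types_with_multiplicity:
    "\<And>l. l \<in> {1..n} \<Longrightarrow> types_with_multiplicity X n l \<in> measurable P (count_space UNIV)"
  and joint_law:
    "\<And>(m :: nat \<Rightarrow> nat) k.
       (\<Sum>j=1..n. m j) = k \<Longrightarrow> (\<Sum>j=1..n. j * m j) = n \<Longrightarrow>
       measure P {\<omega> \<in> space P. (\<forall>j\<in>{1..n}. types_with_multiplicity X n j \<omega> = m j)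
                                 \<and> num_types X n \<omega> = k}
       = fact n * ep_weight_ratio \<alpha> \<theta> k n
         * (\<Prod>j=1..n. (pochhammer (1 - \<alpha>) (j - 1) / fact j) ^ m j * (1 / fact (m j)))"

end

theory Submission
  imports Defs
begin

text \<open>
  Write \<open>c\<^sub>j = (1 - \<alpha>)\<^bsub>j-1\<up>1\<^esub> / j!\<close> and \<open>F(z) = 1 - (1 - z)\<^sup>\<alpha>\<close>. The binomial series gives
  \<open>F(z) = \<alpha> * (\<Sum>j\<ge>1. c\<^sub>j z\<^sup>j)\<close>, so the factors \<open>c\<^sub>j\<close> in the joint law of the multiplicities are, up
  to \<open>\<alpha>\<close>, the Taylor coefficients of \<open>F\<close>. Two different evaluations of the coefficient of \<open>z\<^sup>n\<close> in
  \<open>F(z)\<^sup>k\<close> give the result.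

  By the multinomial theorem the coefficient is \<open>k! \<alpha>\<^sup>k\<close> times the sum of
  \<open>\<Prod>j. c\<^sub>j ^ m\<^sub>j / m\<^sub>j!\<close> over all \<open>m\<close> with \<open>\<Sum>j. m\<^sub>j = k\<close> and \<open>\<Sum>j. j * m\<^sub>j = n\<close>
  (\<open>fps_nth_power_eq_sum_profiles\<close>). Every sample of size \<open>n\<close> with \<open>k\<close> types has a vector of
  multiplicity counts of exactly this kind, so the same sum arises when the joint law is
  marginalised to \<open>K\<^sub>n = k\<close> (\<open>prob_num_types_eq\<close>). On the other hand, \<open>F\<close> is holomorphic on the unit
  disc, and Cauchy's formula expresses the coefficient as the contour integral
  (\<open>contour_integral_eq_fps_nth\<close>). The remaining power \<open>\<alpha>\<^sup>k\<close> converts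
  \<open>\<Prod>i=1..k. \<theta> + (i - 1) \<alpha>\<close> into the rising factorial of \<open>\<theta> / \<alpha>\<close> (\<open>ep_weight_ratio_eq\<close>).
\<close>

section \<open>Powers of a power series\<close>

text \<open>
  Integrality of multinomial coefficients: it lets the coefficients below be written with
  natural-number division, so that the multinomial theorem makes sense in rings without
  inverses of integers, such as the ring of formal power series.
\<close>

lemma prod_fact_dvd_fact_sum:
  fixes m :: "'i \<Rightarrow> nat"
  assumes "finite J"
  shows "(\<Prod>j\<in>J. fact (m j)) dvd (fact (\<Sum>j\<in>J. m j) :: nat)"
  using assms
proof (induction J rule: finite_induct)
  case (insert a J)
  have "(\<Prod>j\<in>insert a J. fact (m j)) dvd fact (m a) * (fact (\<Sum>j\<in>J. m j) :: nat)"
    using insert by (simp add: mult_dvd_mono)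
  also have "\<dots> dvd fact (m a + (\<Sum>j\<in>J. m j))"
    by (rule fact_fact_dvd_fact)
  finally show ?case using insert by simp
qed simp

text \<open>
  Induction on the index set: the binomial theorem splits off one summand \<open>x a\<close>, and its exponent
  \<open>i\<close> together with an exponent function \<open>g\<close> of total degree \<open>k - i\<close> on the rest is the same thing as
  an exponent function of total degree \<open>k\<close> on the larger set. The range bound \<open>{..k}\<close> is implied by
  the condition on the sum; with extensionality it makes the set of exponent functions finite.
\<close>

theorem multinomial_theorem:
  fixes x :: "'i \<Rightarrow> 'a :: comm_semiring_1"
  assumes "finite J"
  shows "(\<Sum>j\<in>J. x j) ^ k =
    (\<Sum>m | m \<in> J \<rightarrow>\<^sub>E {..k} \<and> sum m J = k.
       of_nat (fact k div (\<Prod>j\<in>J. fact (m j))) * (\<Prod>j\<in>J. x j ^ m j))"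
  using assms
proof (induction J arbitrary: k rule: finite_induct)
  case empty
  have "{m. m \<in> {} \<rightarrow>\<^sub>E {..k} \<and> sum m {} = k} = (if k = 0 then {\<lambda>_. undefined} else {})"
    by auto
  then show ?case by (auto simp: power_0_left)
next
  case (insert a J)
  let ?C = "\<lambda>J (k :: nat). {m. m \<in> J \<rightarrow>\<^sub>E {..k} \<and> sum m J = k}"
  let ?T = "\<lambda>J k m. of_nat (fact k div (\<Prod>j\<in>J. fact (m j))) * (\<Prod>j\<in>J. x j ^ m j)"
  have fin: "finite (?C J k)" for k
    by (rule finite_subset[OF _ finite_PiE[OF insert(1), of "\<lambda>_. {..k}"]]) auto
  have eq: "fact k div (fact i * (\<Prod>j\<in>J. fact (g j))) =
      (k choose i) * (fact (k - i) div (\<Prod>j\<in>J. fact (g j)))"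
    if le: "i \<le> k" and sum: "sum g J = k - i" for i g and k :: nat
  proof -
    let ?p = "\<Prod>j\<in>J. fact (g j) :: nat"
    have "?p dvd fact (k - i)"
      using prod_fact_dvd_fact_sum[OF insert(1), of g] sum by simp
    then obtain q where q: "fact (k - i) = ?p * q" ..
    have p: "?p > 0" by (simp add: prod_pos)
    have "fact k = (fact i * ?p) * ((k choose i) * q)"
      using binomial_fact_lemma[OF le] q by (simp add: mult_ac)
    then have "fact k div (fact i * ?p) = (k choose i) * q"
      using p by simp
    then show ?thesis using q p by simp
  qed
  have "(\<Sum>j\<in>insert a J. x j) ^ k = (x a + (\<Sum>j\<in>J. x j)) ^ k"
    using insert by simp
  also have "\<dots> = (\<Sum>i\<le>k. of_nat (k choose i) * x a ^ i * (\<Sum>g\<in>?C J (k - i). ?T J (k - i) g))"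
    unfolding binomial_ring insert.IH by simp
  also have "\<dots> = (\<Sum>(i, g)\<in>Sigma {..k} (\<lambda>i. ?C J (k - i)).
      of_nat (k choose i) * x a ^ i * ?T J (k - i) g)"
    unfolding sum_distrib_left by (rule sum.Sigma) (use fin in auto)
  also have "\<dots> = (\<Sum>m\<in>?C (insert a J) k. ?T (insert a J) k m)"
  proof (rule sum.reindex_bij_witness[where i = "\<lambda>m. (m a, m(a := undefined))"
        and j = "\<lambda>(i, g). g(a := i)"])
    fix p assume "p \<in> Sigma {..k} (\<lambda>i. ?C J (k - i))"
    then obtain i g where p: "p = (i, g)"
      and *: "i \<le> k" "g \<in> J \<rightarrow>\<^sub>E {..k - i}" "sum g J = k - i"
      by auto
    show "(\<lambda>m. (m a, m(a := undefined))) (case p of (i, g) \<Rightarrow> g(a := i)) = p"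
      using PiE_arb[OF *(2) insert(2)] by (simp add: p fun_upd_idem)
    have J: "(\<Sum>j\<in>J. (g(a := i)) j) = sum g J"
        "(\<Prod>j\<in>J. fact ((g(a := i)) j) :: nat) = (\<Prod>j\<in>J. fact (g j))"
        "(\<Prod>j\<in>J. x j ^ (g(a := i)) j) = (\<Prod>j\<in>J. x j ^ g j)"
      using insert(2) by (auto intro!: sum.cong prod.cong)
    have "g \<in> J \<rightarrow>\<^sub>E {..k}"
      using *(2) by (rule PiE_mono[THEN subsetD, rotated]) auto
    then have "g(a := i) \<in> insert a J \<rightarrow>\<^sub>E {..k}"
      using *(1) by (auto simp: PiE_insert_eq)
    moreover have "sum (g(a := i)) (insert a J) = k"
      using *(1,3) insert(1,2) J(1) by simp
    ultimately show "(case p of (i, g) \<Rightarrow> g(a := i)) \<in> ?C (insert a J) k"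
      by (simp add: p)
    show "?T (insert a J) k (case p of (i, g) \<Rightarrow> g(a := i)) =
        (case p of (i, g) \<Rightarrow> of_nat (k choose i) * x a ^ i * ?T J (k - i) g)"
      using insert(1,2) J eq[OF *(1,3)] by (simp add: p mult_ac)
  next
    fix m assume "m \<in> ?C (insert a J) k"
    then have m: "m \<in> insert a J \<rightarrow>\<^sub>E {..k}" "k = sum m (insert a J)" by auto
    show "(case (m a, m(a := undefined)) of (i, g) \<Rightarrow> g(a := i)) = m"
      by simp
    have J: "(\<Sum>j\<in>J. (m(a := undefined)) j) = sum m J"
      using insert(2) by (auto intro!: sum.cong)
    have "m j \<le> sum m J" if "j \<in> J" for j
      using that insert(1) by (simp add: member_le_sum)
    then show "(m a, m(a := undefined)) \<in> Sigma {..k} (\<lambda>i. ?C J (k - i))"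
      using m insert(1,2) J by (auto simp: PiE_iff extensional_def)
  qed
  finally show ?case .
qed

text \<open>
  The first \<open>n + 1\<close> coefficients determine those of a power, which permits replacing a power series
  by a polynomial.
\<close>

lemma fps_nth_power_cong:
  fixes f g :: "'a :: comm_semiring_1 fps"
  assumes "\<And>i. i \<le> n \<Longrightarrow> f $ i = g $ i"
  shows "(f ^ k) $ n = (g ^ k) $ n"
  using assms
proof (induction k arbitrary: n)
  case (Suc k)
  then show ?case
    by (auto simp: fps_mult_nth intro!: sum.cong arg_cong2[where f = "(*)"])
qed simp

text \<open>
  The partitions of the integer \<open>n\<close> into \<open>k\<close> parts, where \<open>m j\<close> is the number of parts of size \<open>j\<close>.
  Functions are extensional so that each partition has only one representative.
\<close>

definition partition_profiles :: "nat \<Rightarrow> nat \<Rightarrow> (nat \<Rightarrow> nat) set" where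
  "partition_profiles n k =
     {m \<in> {1..n} \<rightarrow>\<^sub>E {..k}. (\<Sum>j=1..n. m j) = k \<and> (\<Sum>j=1..n. j * m j) = n}"

lemma finite_partition_profiles: "finite (partition_profiles n k)"
  unfolding partition_profiles_def
  by (rule finite_subset[OF _ finite_PiE[of "{1..n}" "\<lambda>_. {..k}"]]) auto

text \<open>
  Expanding the \<open>k\<close>-th power of the truncated series by the multinomial theorem, the term with
  exponents \<open>m\<close> is a multiple of \<open>X\<close> to the power \<open>\<Sum>j. j * m j\<close>, so only partitions of \<open>n\<close> contribute.
  The assumption that \<open>F\<close> has no constant term matters because part sizes start at \<open>1\<close>.
\<close>

lemma fps_nth_power_eq_sum_profiles:
  fixes F :: "'a :: field_char_0 fps"
  assumes "F $ 0 = 0"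
  shows "(F ^ k) $ n =
    fact k * (\<Sum>m\<in>partition_profiles n k. \<Prod>j=1..n. (F $ j) ^ m j * (1 / fact (m j)))"
proof -
  let ?G = "\<Sum>j=1..n. fps_const (F $ j) * fps_X ^ j"
  let ?C = "{m. m \<in> {1..n} \<rightarrow>\<^sub>E {..k} \<and> sum m {1..n} = k}"
  have "F $ i = ?G $ i" if "i \<le> n" for i
  proof -
    have "?G $ i = (\<Sum>j=1..n. if i = j then F $ j else 0)"
      by (simp add: fps_sum_nth fps_X_power_nth if_distrib cong: if_cong)
    then show ?thesis using that assms by (cases "i = 0") auto
  qed
  then have "(F ^ k) $ n = (?G ^ k) $ n" by (rule fps_nth_power_cong)
  also have "?G ^ k = (\<Sum>m\<in>?C. of_nat (fact k div (\<Prod>j=1..n. fact (m j))) *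
      (\<Prod>j=1..n. (fps_const (F $ j) * fps_X ^ j) ^ m j))"
    by (rule multinomial_theorem) simp
  also have "\<dots> $ n = (\<Sum>m\<in>?C. if (\<Sum>j=1..n. j * m j) = n
      then fact k * (\<Prod>j=1..n. (F $ j) ^ m j * (1 / fact (m j))) else 0)"
    unfolding fps_sum_nth
  proof (rule sum.cong[OF refl])
    fix m assume m: "m \<in> ?C"
    let ?p = "\<Prod>j=1..n. fact (m j) :: nat"
    have prod: "(\<Prod>j=1..n. (fps_const (F $ j) * fps_X ^ j) ^ m j)
        = fps_const (\<Prod>j=1..n. (F $ j) ^ m j) * fps_X ^ (\<Sum>j=1..n. j * m j)"
    proof -
      have "(\<Prod>j\<in>J. (fps_const (F $ j) * fps_X ^ j) ^ m j)
        = fps_const (\<Prod>j\<in>J. (F $ j) ^ m j) * fps_X ^ (\<Sum>j\<in>J. j * m j)" for J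
        by (induction J rule: infinite_finite_induct)
          (auto simp: power_mult_distrib power_mult power_add fps_const_power
            fps_const_mult[symmetric] mult_ac simp del: fps_const_mult)
      then show ?thesis .
    qed
    have "?p dvd fact k"
      using prod_fact_dvd_fact_sum[of "{1..n}" m] m by auto
    then have "of_nat (fact k div ?p) = (fact k / (\<Prod>j=1..n. fact (m j)) :: 'a)"
    proof (elim dvdE)
      fix q assume q: "fact k = ?p * q"
      have "(fact k :: 'a) = of_nat (fact k)" by (rule of_nat_fact[symmetric])
      also have "\<dots> = (\<Prod>j=1..n. fact (m j)) * of_nat q"
        unfolding q by (simp only: of_nat_mult of_nat_prod of_nat_fact)
      finally have "(fact k :: 'a) = (\<Prod>j=1..n. fact (m j)) * of_nat q" .
      moreover have "?p > 0" by (simp add: prod_pos)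
      ultimately show ?thesis by (simp add: q)
    qed
    then show "(of_nat (fact k div ?p) *
        (\<Prod>j=1..n. (fps_const (F $ j) * fps_X ^ j) ^ m j)) $ n =
        (if (\<Sum>j=1..n. j * m j) = n
         then fact k * (\<Prod>j=1..n. (F $ j) ^ m j * (1 / fact (m j))) else 0)"
      unfolding prod
      by (auto simp: fps_of_nat[symmetric] fps_X_power_nth prod.distrib prod_dividef
          simp del: of_nat_fact)
  qed
  also have "\<dots> = (\<Sum>m\<in>partition_profiles n k. fact k * (\<Prod>j=1..n. (F $ j) ^ m j * (1 / fact (m j))))"
  proof -
    have "finite ?C"
      by (rule finite_subset[OF _ finite_PiE[of "{1..n}" "\<lambda>_. {..k}"]]) auto
    then show ?thesis
      by (subst sum.inter_filter[symmetric])
         (auto simp: partition_profiles_def intro!: sum.cong)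
  qed
  finally show ?thesis by (simp add: sum_distrib_left)
qed

section \<open>The Taylor series of \<open>1 - (1 - z)\<^sup>\<alpha>\<close>\<close>

definition one_minus_powr_fps :: "real \<Rightarrow> complex fps" where
  "one_minus_powr_fps \<alpha> = 1 - (fps_binomial (complex_of_real \<alpha>) oo - fps_X)"

lemma one_minus_powr_has_fps_expansion:
  "(\<lambda>z. 1 - (1 - z) powr complex_of_real \<alpha>) has_fps_expansion one_minus_powr_fps \<alpha>"
proof -
  have "((\<lambda>z. (1 + z) powr complex_of_real \<alpha>) \<circ> (\<lambda>z. - z)) has_fps_expansion
      (fps_binomial (complex_of_real \<alpha>) oo - fps_X)"
    by (intro has_fps_expansion_compose fps_expansion_intros) auto
  then show ?thesis
    unfolding one_minus_powr_fps_def
    by (intro fps_expansion_intros) (simp add: o_def)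
qed

text \<open>
  The constant terms cancel, and for \<open>j \<ge> 1\<close> the binomial coefficient of \<open>\<alpha>\<close> is a rising factorial of
  \<open>- \<alpha>\<close>, whose first factor is the \<open>\<alpha>\<close> in front and whose other factors start at \<open>1 - \<alpha>\<close>.
\<close>

lemma one_minus_powr_fps_nth:
  "one_minus_powr_fps \<alpha> $ j =
     (if j = 0 then 0 else complex_of_real (\<alpha> * (pochhammer (1 - \<alpha>) (j - 1) / fact j)))"
proof (cases j)
  case (Suc i)
  have "pochhammer (- complex_of_real \<alpha>) (Suc i) = - (\<alpha> * complex_of_real (pochhammer (1 - \<alpha>) i))"
    by (simp add: pochhammer_rec pochhammer_of_real[symmetric])
  then show ?thesis
    unfolding one_minus_powr_fps_def fps_compose_uminus'
    by (simp add: Suc gbinomial_pochhammer mult.assoc[symmetric] power_mult_distrib[symmetric] del: power_Suc pochhammer_Suc)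
qed (simp add: one_minus_powr_fps_def)

lemma contour_integral_eq_fps_nth:
  assumes "f has_fps_expansion F" "f holomorphic_on ball 0 R" "0 < r" "r < R"
  shows "contour_integral (circlepath 0 r) (\<lambda>z. f z / z ^ (n + 1)) = 2 * complex_of_real pi * \<i> * F $ n"
proof -
  have "cball 0 r \<subseteq> ball (0::complex) R" "ball 0 r \<subseteq> ball (0::complex) R" using assms by auto
  then have "contour_integral (circlepath 0 r) (\<lambda>z. f z / (z - 0) ^ Suc n)
      = 2 * pi * \<i> * (deriv ^^ n) f 0 / fact n"
    using assms 
    by (intro Cauchy_contour_integral_circlepath holomorphic_on_imp_continuous_on)
       (auto intro: holomorphic_on_subset)
  then show ?thesis by (simp add: fps_nth_fps_expansion[OF assms(1)])
qed

section \<open>The law of the number of types\<close>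

text \<open>
  Both sides count the draws: the left side groups them by the multiplicity of their type.
  Hence the observed counts always form a partition of \<open>n\<close>, and the joint law covers every outcome.
\<close>

lemma sum_mult_types_with_multiplicity:
  "(\<Sum>l=1..n. l * types_with_multiplicity X n l \<omega>) = n"
proof -
  let ?S = "(\<lambda>i. X i \<omega>) ` {1..n}"
  let ?\<mu> = "type_multiplicity X n \<omega>"
  have S: "t \<in> ?S" if "?\<mu> t \<ge> 1" for t
    using that unfolding type_multiplicity_def by (auto simp: Suc_le_eq card_gt_0_iff)
  have "?\<mu> t \<in> {1..n}" if "t \<in> ?S" for t
  proof -
    have "?\<mu> t \<le> card {1..n}"
      unfolding type_multiplicity_def by (rule card_mono) auto
    moreover have "?\<mu> t > 0"
      using that unfolding type_multiplicity_def card_gt_0_iff by auto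
    ultimately show ?thesis by simp
  qed
  then have img: "?\<mu> ` ?S \<subseteq> {1..n}" by blast
  have "(\<Sum>l=1..n. l * types_with_multiplicity X n l \<omega>) = (\<Sum>l=1..n. \<Sum>t | t \<in> ?S \<and> ?\<mu> t = l. ?\<mu> t)"
  proof (rule sum.cong[OF refl])
    fix l assume "l \<in> {1..n}"
    then have "{t. ?\<mu> t = l} = {t. t \<in> ?S \<and> ?\<mu> t = l}" using S by auto
    then show "l * types_with_multiplicity X n l \<omega> = (\<Sum>t | t \<in> ?S \<and> ?\<mu> t = l. ?\<mu> t)"
      by (simp add: types_with_multiplicity_def)
  qed
  also have "\<dots> = (\<Sum>t\<in>?S. ?\<mu> t)"
    using sum.group[OF _ _ img, of ?\<mu>] by simp
  also have "\<dots> = (\<Sum>t\<in>?S. \<Sum>i | i \<in> {1..n} \<and> X i \<omega> = t. 1)"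
    by (simp add: type_multiplicity_def)
  also have "\<dots> = n"
    by (subst sum.group) auto
  finally show ?thesis .
qed

text \<open>
  The event is the finite disjoint union, over all partitions of \<open>n\<close> into \<open>k\<close> parts, of the events
  whose probability the joint law prescribes.
\<close>

lemma (in ewens_pitman_sample) prob_num_types_eq:
  "prob {\<omega> \<in> space P. num_types X n \<omega> = k} = fact n * ep_weight_ratio \<alpha> \<theta> k n *
     (\<Sum>m\<in>partition_profiles n k.
        \<Prod>j=1..n. (pochhammer (1 - \<alpha>) (j - 1) / fact j) ^ m j * (1 / fact (m j)))"
proof -
  define E where "E m = {\<omega> \<in> space P. (\<forall>j\<in>{1..n}. types_with_multiplicity X n j \<omega> = m j)
                                 \<and> num_types X n \<omega> = k}" for m
  note [measurable] = measurable_types_with_multiplicity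
  have E_sets: "E m \<in> events" for m
    unfolding E_def num_types_def by measurable
  have "{\<omega> \<in> space P. num_types X n \<omega> = k} = (\<Union>m\<in>partition_profiles n k. E m)"
  proof (intro equalityI subsetI)
    fix \<omega> assume \<omega>: "\<omega> \<in> {\<omega> \<in> space P. num_types X n \<omega> = k}"
    define m where "m = restrict (\<lambda>j. types_with_multiplicity X n j \<omega>) {1..n}"
    have sums: "(\<Sum>j=1..n. m j) = k" "(\<Sum>j=1..n. j * m j) = n"
      using \<omega> sum_mult_types_with_multiplicity[of X n \<omega>] by (simp_all add: m_def num_types_def)
    have "m j \<le> k" if "j \<in> {1..n}" for j
      using member_le_sum[of j "{1..n}" m] that sums(1) by simp
    then have "m \<in> partition_profiles n k"
      using sums by (auto simp: partition_profiles_def m_def)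
    moreover have "\<omega> \<in> E m"
      using \<omega> by (simp add: E_def m_def)
    ultimately show "\<omega> \<in> (\<Union>m\<in>partition_profiles n k. E m)" by blast
  qed (auto simp: E_def)
  also have "prob \<dots> = (\<Sum>m\<in>partition_profiles n k. prob (E m))"
  proof (rule finite_measure_finite_Union[OF finite_partition_profiles])
    show "disjoint_family_on E (partition_profiles n k)"
      unfolding disjoint_family_on_def
    proof (intro ballI impI)
      fix m m' assume *: "m \<in> partition_profiles n k" "m' \<in> partition_profiles n k" "m \<noteq> m'"
      then obtain j where "j \<in> {1..n}" "m j \<noteq> m' j"
        unfolding partition_profiles_def by (metis (no_types, lifting) PiE_ext mem_Collect_eq)
      then show "E m \<inter> E m' = {}"
        unfolding E_def by fastforce
    qed
  qed (use E_sets in auto)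
  also have "\<dots> = (\<Sum>m\<in>partition_profiles n k. fact n * ep_weight_ratio \<alpha> \<theta> k n
         * (\<Prod>j=1..n. (pochhammer (1 - \<alpha>) (j - 1) / fact j) ^ m j * (1 / fact (m j))))"
    unfolding E_def by (intro sum.cong refl joint_law) (auto simp: partition_profiles_def)
  finally show ?thesis by (simp add: sum_distrib_left)
qed

text \<open>
  Each of the \<open>k\<close> factors \<open>\<theta> + (i - 1) \<alpha>\<close> equals \<open>\<alpha> * (\<theta> / \<alpha> + (i - 1))\<close>. At \<open>\<theta> = 0\<close> the first factor is
  cancelled in both ratios, which leaves \<open>k - 1\<close> factors \<open>\<alpha>\<close>; the factor \<open>1 / \<alpha>\<close> in
  \<open>ep_pochhammer_ratio\<close> accounts for the missing one.
\<close>

lemma ep_weight_ratio_eq: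
  assumes "\<alpha> \<noteq> 0" "k \<ge> 1"
  shows "ep_weight_ratio \<alpha> \<theta> k n = \<alpha> ^ k * ep_pochhammer_ratio \<alpha> \<theta> k n"
proof (cases "\<theta> = 0")
  case True
  obtain i where k: "k = Suc i" using assms by (cases k) auto
  have "(\<Prod>i=2..k. (real i - 1) * \<alpha>) = \<alpha> ^ i * fact i"
    unfolding k
  proof (induction i)
    case (Suc i)
    then show ?case by (simp add: algebra_simps)
  qed simp
  then show ?thesis
    using True assms by (simp add: ep_weight_ratio_def ep_pochhammer_ratio_def k pochhammer_fact[symmetric])
next
  case False
  have "(\<Prod>i=1..k. \<theta> + (real i - 1) * \<alpha>) = \<alpha> ^ k * pochhammer (\<theta> / \<alpha>) k"
  proof (induction k)
    case (Suc k)
    then show ?case using assms by (simp add: pochhammer_Suc field_simps)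
  qed simp
  then show ?thesis
    using False by (simp add: ep_weight_ratio_def ep_pochhammer_ratio_def)
qed

theorem lemma2p2:
  fixes P :: "'a measure" and X :: "nat \<Rightarrow> 'a \<Rightarrow> 't"
    and \<alpha> \<theta> r :: real and n k :: nat
  assumes "0 < \<alpha>" and "\<alpha> < 1" and "\<theta> > - \<alpha>"
    and "ewens_pitman_sample P X \<alpha> \<theta> n"
    and "1 \<le> k" and "k \<le> n"
    and "0 < r" and "r < 1"
  shows "complex_of_real (measure P {\<omega> \<in> space P. num_types X n \<omega> = k})
       = complex_of_real (fact n / fact k * ep_pochhammer_ratio \<alpha> \<theta> k n)
         * (1 / (2 * complex_of_real pi * \<i>))
         * contour_integral (circlepath 0 r)
             (\<lambda>z. (1 - (1 - z) powr complex_of_real \<alpha>) ^ k / z ^ (n + 1))"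
proof -
  interpret ewens_pitman_sample P X \<alpha> \<theta> n by fact
  let ?c = "\<lambda>j. pochhammer (1 - \<alpha>) (j - 1) / fact j"
  let ?f = "\<lambda>z. 1 - (1 - z) powr complex_of_real \<alpha>"
  let ?F = "one_minus_powr_fps \<alpha>"
  let ?S = "\<Sum>m\<in>partition_profiles n k. \<Prod>j=1..n. ?c j ^ m j * (1 / fact (m j))"
  \<comment> \<open>The unit disc avoids the branch cut.\<close>
  have "1 - z \<notin> \<real>\<^sub>\<le>\<^sub>0" if "norm z < 1" for z :: complex
    using that complex_Re_le_cmod[of z] by (auto simp: complex_nonpos_Reals_iff)
  then have "(\<lambda>z. ?f z ^ k) holomorphic_on ball 0 1"
    by (intro holomorphic_intros) auto
  then have "contour_integral (circlepath 0 r) (\<lambda>z. ?f z ^ k / z ^ (n + 1))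
      = 2 * complex_of_real pi * \<i> * (?F ^ k) $ n"
    by (intro contour_integral_eq_fps_nth[where R = 1] has_fps_expansion_power
        one_minus_powr_has_fps_expansion assms)
  \<comment> \<open>Each Taylor coefficient carries one factor \<open>\<alpha>\<close>, and the exponents sum to \<open>k\<close>.\<close>
  moreover have "(?F ^ k) $ n = complex_of_real (fact k * \<alpha> ^ k * ?S)"
  proof -
    have "(\<Prod>j=1..n. (?F $ j) ^ m j * (1 / fact (m j)))
        = complex_of_real (\<alpha> ^ k * (\<Prod>j=1..n. ?c j ^ m j * (1 / fact (m j))))"
      if "m \<in> partition_profiles n k" for m
    proof -
      have "(\<Prod>j=1..n. (?F $ j) ^ m j * (1 / fact (m j)))
          = complex_of_real (\<Prod>j=1..n. \<alpha> ^ m j * (?c j ^ m j * (1 / fact (m j))))"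
        unfolding of_real_prod
        by (rule prod.cong) (auto simp: one_minus_powr_fps_nth power_mult_distrib power_divide)
      also have "(\<Prod>j=1..n. \<alpha> ^ m j * (?c j ^ m j * (1 / fact (m j))))
          = \<alpha> ^ (\<Sum>j=1..n. m j) * (\<Prod>j=1..n. ?c j ^ m j * (1 / fact (m j)))"
        by (simp only: prod.distrib power_sum)
      also have "(\<Sum>j=1..n. m j) = k"
        using that by (simp add: partition_profiles_def)
      finally show ?thesis .
    qed
    then have "(\<Sum>m\<in>partition_profiles n k. \<Prod>j=1..n. (?F $ j) ^ m j * (1 / fact (m j)))
        = complex_of_real (\<alpha> ^ k * ?S)"
      unfolding sum_distrib_left of_real_sum by (intro sum.cong refl)
    then show ?thesis
      by (subst fps_nth_power_eq_sum_profiles) (simp_all add: one_minus_powr_fps_nth)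
  qed
  ultimately show ?thesis
    unfolding prob_num_types_eq ep_weight_ratio_eq[OF less_imp_neq[OF assms(1), symmetric] assms(5)]
    by simp
qed

end
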